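(* Let $\mathcal P=\{\mathcal A+\lambda\mathcal B\}$ be a Poisson pencil on $M$ and let $\lambda(x)$ be a finite eigenvalue of $\mathcal P(x)$ depending on $x\in M$, which is real-valued $C^\infty$ in the real case and holomorphic in the complex case. Assume (1) $\operatorname{rk}\mathcal P(x)$ is constant on $M$, and (2) $\lambda(x)$ is an isolated eigenvalue. Then for every $x\in M$, $$(\mathcal A-\lambda(x)\mathcal B)\,d\lambda(x)=0,$$ i.e. $d\lambda(x)\in\operatorname{Ker}\mathcal A_{-\lambda(x)}(x)$.
   Context: $M$ is a real $C^\infty$ or complex analytic manifold; a Poisson pencil is $\mathcal P=\{\mathcal A_\lambda=\mathcal A+\lambda\mathcal B\}$ with $\mathcal A,\mathcal B$ compatible Poisson brackets. At $x$, $\mathcal P(x)$ is the linear pencil of skew forms on $T_x^*M$, $\operatorname{rk}\mathcal P(x)=\max_\lambda\operatorname{rk}\mathcal A_\lambda(x)$. A number $\lambda_0$ is an eigenvalue of $\mathcal P(x)$ if $\operatorname{rk}(\mathcal A-\lambda_0\mathcal B)(x)<\operatorname{rk}\mathcal P(x)$ (equivalently, a root of the characteristic polynomial). An eigenvalue $\lambda(x)$ is isolated if there is a neighbourhood $U\subset M\times\mathbb C$ of its graph $\{(x,\lambda(x)):x\in M\}$ containing no other eigenvalues, i.e. no point $(x,\mu)\in U$ with $\mu\neq\lambda(x)$ an eigenvalue of $\mathcal P(x)$. The bivector $\mathcal A-\lambda(x)\mathcal B$ at $x$ is viewed as a map $T^*_xM\to T_xM$. *)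

theory Defs
  imports "HOL-Analysis.Analysis"
begin

text \<open>Local coordinates: a (real or complex) manifold is modelled by an open subset of
  K^n, with K = real or complex; n is the finite index type 'n.  A bivector field
  is a matrix-valued function (its matrix in the coordinate basis); viewed as a map
  T*M -> TM it sends a covector with components c to the vector (sum_j P_ij c_j)_i.\<close>

text \<open>Partial derivative d/dx_l (resp. d/dz_l) of a scalar function at x.\<close>
definition pd :: "('a::real_normed_field^'n \<Rightarrow> 'a) \<Rightarrow> 'a^'n \<Rightarrow> 'n \<Rightarrow> 'a" where
  "pd f x l = frechet_derivative f (at x) (axis l 1)"

text \<open>Real C-infinity functions on an open set: all iterated partial derivatives exist
  (D ds is the iterated partial derivative along the list of directions ds).\<close>
definition smooth_on :: "(real^'n) set \<Rightarrow> (real^'n \<Rightarrow> real) \<Rightarrow> bool" where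
  "smooth_on U f \<longleftrightarrow>
     (\<exists>D :: 'n list \<Rightarrow> real^'n \<Rightarrow> real.
        (\<forall>x\<in>U. D [] x = f x) \<and>
        (\<forall>ds. \<forall>x\<in>U. (D ds has_derivative (\<lambda>v. \<Sum>i\<in>UNIV. v$i * D (i # ds) x)) (at x)))"

text \<open>Holomorphic functions of several complex variables on an open set:
  complex (Frechet) differentiable at every point.\<close>
definition holo_on :: "(complex^'n) set \<Rightarrow> (complex^'n \<Rightarrow> complex) \<Rightarrow> bool" where
  "holo_on U f \<longleftrightarrow>
     (\<forall>x\<in>U. \<exists>f'. (f has_derivative f') (at x) \<and> (\<forall>c v. f' (c *s v) = c * f' v))"

text \<open>Poisson bivector on U: skew-symmetric with vanishing Schouten bracket [P,P]
  (Jacobi identity in coordinates).\<close>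
definition poisson_on :: "('a::real_normed_field^'n) set \<Rightarrow> ('a^'n \<Rightarrow> 'a^'n^'n) \<Rightarrow> bool" where
  "poisson_on U P \<longleftrightarrow>
     (\<forall>x\<in>U. (\<forall>i j. P x $ i $ j = - P x $ j $ i) \<and>
       (\<forall>i j k. (\<Sum>l\<in>UNIV. P x $ i $ l * pd (\<lambda>y. P y $ j $ k) x l
                          + P x $ j $ l * pd (\<lambda>y. P y $ k $ i) x l
                          + P x $ k $ l * pd (\<lambda>y. P y $ i $ j) x l) = 0))"

text \<open>Compatible Poisson brackets: A, B and A + B are Poisson.\<close>
definition poisson_pencil_on :: "('a::real_normed_field^'n) set \<Rightarrow> ('a^'n \<Rightarrow> 'a^'n^'n) \<Rightarrow> ('a^'n \<Rightarrow> 'a^'n^'n) \<Rightarrow> bool" where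
  "poisson_pencil_on U A B \<longleftrightarrow> poisson_on U A \<and> poisson_on U B \<and> poisson_on U (\<lambda>x. A x + B x)"

text \<open>Complexification of a real matrix.\<close>
definition cplx :: "real^'n^'m \<Rightarrow> complex^'n^'m" where
  "cplx A = (\<chi> i j. complex_of_real (A $ i $ j))"

text \<open>rk P = max over lambda in C of rk (A + lambda B).\<close>
definition pencil_rank :: "complex^'n^'n \<Rightarrow> complex^'n^'n \<Rightarrow> nat" where
  "pencil_rank A B = Max ((\<lambda>\<mu>. rank (\<chi> i j. A $ i $ j + \<mu> * B $ i $ j)) ` UNIV)"

text \<open>mu is an eigenvalue of the pencil: rk (A - mu B) < rk P.\<close>
definition pencil_eigenvalue :: "complex^'n^'n \<Rightarrow> complex^'n^'n \<Rightarrow> complex \<Rightarrow> bool" where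
  "pencil_eigenvalue A B \<mu> \<longleftrightarrow> rank (\<chi> i j. A $ i $ j - \<mu> * B $ i $ j) < pencil_rank A B"

end

theory Submission
  imports Defs "HOL-Complex_Analysis.Cauchy_Integral_Formula"
begin

lemma norm_integral_le_length:
  fixes g :: "real \<Rightarrow> 'v::real_normed_vector"
  assumes "g integrable_on {0..c}" "0 \<le> c" "\<And>s. s \<in> {0..c} \<Longrightarrow> norm (g s) \<le> K"
  shows "norm (integral {0..c} g) \<le> K * c"
proof -
  have "0 \<le> K" using order_trans[OF norm_ge_zero assms(3)[of 0]] assms(2) by simp
  then show ?thesis
    using has_integral_bound[of K g "integral {0..c} g" 0 c] assms by (simp add: has_integral_integral)
qed

lemma bounded_lipschitz_ode_solvable:
  fixes g :: "real \<Rightarrow> 'v::banach \<Rightarrow> 'v"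
  assumes "0 < h" "0 \<le> L" "h * L < 1"
    and g_cont: "continuous_on ({0..h} \<times> UNIV) (\<lambda>(s, y). g s y)"
    and g_bound: "\<And>s y. s \<in> {0..h} \<Longrightarrow> norm (g s y) \<le> K"
    and g_lip: "\<And>s y z. s \<in> {0..h} \<Longrightarrow> norm (g s y - g s z) \<le> L * norm (y - z)"
  obtains y where "y 0 = y0"
    "\<And>t. t \<in> {0..h} \<Longrightarrow> norm (y t - y0) \<le> K * t"
    "\<And>t. t \<in> {0..h} \<Longrightarrow> (y has_vector_derivative g t (y t)) (at t within {0..h})"
proof -
  define clamp where "clamp t = max 0 (min h t)" for t
  have clamp: "0 \<le> clamp t" "clamp t \<le> h" for t
    using \<open>0 < h\<close> by (auto simp: clamp_def)
  have clamp_cont: "continuous_on UNIV clamp"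
    unfolding clamp_def by (intro continuous_intros)
  have gu_cont: "continuous_on {0..h} (\<lambda>s. g s (u s))" if "continuous_on UNIV u" for u
  proof -
    have "continuous_on {0..h} ((\<lambda>(s, y). g s y) \<circ> (\<lambda>s. (s, u s)))"
      by (intro continuous_on_compose continuous_intros continuous_on_subset[OF that]
          continuous_on_subset[OF g_cont]) auto
    then show ?thesis by (simp add: o_def)
  qed
  have gu_int: "(\<lambda>s. g s (u s)) integrable_on {0..b}"
    if "continuous_on UNIV u" "b \<in> {0..h}" for u b
    using that by (intro integrable_continuous_real continuous_on_subset[OF gu_cont]) auto
  have K_nonneg: "0 \<le> K"
    using order_trans[OF norm_ge_zero g_bound[of 0 0]] \<open>0 < h\<close> by simp
  define F where "F u t = y0 + integral {0..clamp t} (\<lambda>s. g s (u s))"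
    for u :: "real \<Rightarrow>\<^sub>C 'v" and t
  have F_bcontfun: "F u \<in> bcontfun" for u
  proof (rule bcontfun_normI)
    have "continuous_on {0..h} (\<lambda>t. integral {0..t} (\<lambda>s. g s (u s)))"
      by (rule indefinite_integral_continuous_1, rule gu_int) (use \<open>0 < h\<close> in simp_all)
    then have "continuous_on UNIV ((\<lambda>t. integral {0..t} (\<lambda>s. g s (u s))) \<circ> clamp)"
      by (rule continuous_on_compose[OF clamp_cont continuous_on_subset]) (auto simp: clamp)
    then show "continuous_on UNIV (F u)"
      unfolding F_def o_def by (intro continuous_intros)
    fix t
    have "norm (F u t) \<le> norm y0 + norm (integral {0..clamp t} (\<lambda>s. g s (u s)))"
      unfolding F_def by (rule norm_triangle_ineq)
    also have "\<dots> \<le> norm y0 + K * clamp t"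
      by (intro add_left_mono norm_integral_le_length gu_int)
        (use clamp[of t] in \<open>auto intro!: g_bound\<close>)
    also have "\<dots> \<le> norm y0 + K * h"
      using clamp[of t] K_nonneg by (intro add_left_mono mult_left_mono) auto
    finally show "norm (F u t) \<le> norm y0 + K * h" .
  qed
  define T where "T u = Bcontfun (F u)" for u
  have T_apply: "apply_bcontfun (T u) t = F u t" for u t
    unfolding T_def using F_bcontfun[of u] by (simp add: Bcontfun_inverse)
  have "dist (T u) (T v) \<le> (h * L) * dist u v" for u v
  proof (rule dist_bound)
    fix t
    have lip_uv: "norm (g s (u s) - g s (v s)) \<le> L * dist u v" if "s \<in> {0..h}" for s
    proof -
      have "L * norm (u s - v s) \<le> L * dist u v"
        using dist_bounded[of u s v] \<open>0 \<le> L\<close> by (simp add: dist_norm mult_left_mono)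
      then show ?thesis using g_lip[OF that, of "u s" "v s"] by linarith
    qed
    have int_t: "(\<lambda>s. g s (w s)) integrable_on {0..clamp t}" for w :: "real \<Rightarrow>\<^sub>C 'v"
      by (rule gu_int) (simp_all add: clamp)
    have "F u t - F v t = integral {0..clamp t} (\<lambda>s. g s (u s) - g s (v s))"
      by (simp add: F_def integral_diff[OF int_t int_t])
    also have "norm \<dots> \<le> L * dist u v * clamp t"
      by (rule norm_integral_le_length[OF integrable_diff[OF int_t int_t]])
        (use clamp[of t] lip_uv in auto)
    also have "\<dots> \<le> L * dist u v * h"
      using clamp[of t] \<open>0 \<le> L\<close> by (intro mult_left_mono) auto
    finally show "dist (T u t) (T v t) \<le> (h * L) * dist u v"
      by (simp add: T_apply dist_norm mult_ac)
  qed
  then obtain Y where "T Y = Y"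
    using banach_fix_type[of "h * L" T] \<open>0 < h\<close> assms(2,3) by auto
  then have Y_fix: "apply_bcontfun Y t = F Y t" for t
    using T_apply[of Y t] by simp
  have Y_eq: "Y t = y0 + integral {0..t} (\<lambda>s. g s (Y s))" if "t \<in> {0..h}" for t
  proof -
    have "clamp t = t" using that by (simp add: clamp_def)
    then show ?thesis using Y_fix[of t] by (simp add: F_def)
  qed
  show thesis
  proof (rule that[of "apply_bcontfun Y"])
    show "Y 0 = y0" using Y_eq[of 0] \<open>0 < h\<close> by simp
    fix t :: real
    assume t: "t \<in> {0..h}"
    have "norm (integral {0..t} (\<lambda>s. g s (Y s))) \<le> K * t"
      by (rule norm_integral_le_length[OF gu_int]) (use t in \<open>auto intro!: g_bound\<close>)
    then show "norm (Y t - y0) \<le> K * t" using Y_eq[OF t] by simp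
    have "((\<lambda>t. integral {0..t} (\<lambda>s. g s (Y s))) has_vector_derivative g t (Y t))
        (at t within {0..h})"
      by (rule integral_has_vector_derivative[OF gu_cont t]) simp
    from has_vector_derivative_add[OF has_vector_derivative_const this]
    have D: "((\<lambda>t. y0 + integral {0..t} (\<lambda>s. g s (Y s))) has_vector_derivative g t (Y t))
        (at t within {0..h})"
      by simp
    show "(Y has_vector_derivative g t (Y t)) (at t within {0..h})"
      by (rule has_vector_derivative_transform[OF t _ D]) (simp add: Y_eq)
  qed
qed

lemma ode_local_existence:
  fixes f :: "real \<Rightarrow> 'v::euclidean_space \<Rightarrow> 'v"
  assumes "0 < h0" "0 < R"
    and f_cont: "continuous_on ({0..h0} \<times> cball y0 R) (\<lambda>(t, y). f t y)"
    and f_lip: "\<And>t y z. t \<in> {0..h0} \<Longrightarrow> y \<in> cball y0 R \<Longrightarrow> z \<in> cball y0 R \<Longrightarrow>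
                  norm (f t y - f t z) \<le> L * norm (y - z)"
  obtains h y where "0 < h" "h \<le> h0" "y 0 = y0" "\<And>t. t \<in> {0..h} \<Longrightarrow> y t \<in> cball y0 R"
    "\<And>t. t \<in> {0..h} \<Longrightarrow> (y has_vector_derivative f t (y t)) (at t within {0..h})"
proof -
  define C where "C = cball y0 R"
  define p where "p = closest_point C"
  have C: "convex C" "closed C" "C \<noteq> {}"
    unfolding C_def using \<open>0 < R\<close> by auto
  have p_in: "p y \<in> C" for y
    unfolding p_def using closest_point_in_set C by blast
  have p_id: "y \<in> C \<Longrightarrow> p y = y" for y
    unfolding p_def by (rule closest_point_self)
  have p_lip: "norm (p y - p z) \<le> norm (y - z)" for y z
    unfolding p_def using closest_point_lipschitz[OF C(1,2)] C(3) by (simp add: dist_norm)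
  have p_cont: "continuous_on UNIV p"
    unfolding p_def using continuous_on_closest_point C by blast
  have "compact ((\<lambda>(t, y). f t y) ` ({0..h0} \<times> C))"
    unfolding C_def by (intro compact_continuous_image f_cont compact_Times) auto
  then obtain K0 where "\<forall>z\<in>(\<lambda>(t, y). f t y) ` ({0..h0} \<times> C). norm z \<le> K0"
    using compact_imp_bounded bounded_iff by blast
  then have K0: "norm (f t y) \<le> K0" if "t \<in> {0..h0}" "y \<in> C" for t y
    using that by force
  define K where "K = max K0 1"
  define L' where "L' = \<bar>L\<bar> + 1"
  define h where "h = min h0 (min (R / K) (1 / (2 * L')))"
  have "0 < K" "0 < L'" unfolding K_def L'_def by auto
  have "h \<le> R / K" "h \<le> 1 / (2 * L')"
    by (simp_all add: h_def)
  then have h: "0 < h" "h \<le> h0" "h * K \<le> R" "h * L' < 1"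
    using \<open>0 < h0\<close> \<open>0 < R\<close> \<open>0 < K\<close> \<open>0 < L'\<close> by (auto simp: h_def field_simps)
  define g where "g s y = f s (p y)" for s y
  have "continuous_on ({0..h} \<times> UNIV) ((\<lambda>(t, y). f t y) \<circ> (\<lambda>z. (fst z, p (snd z))))"
  proof (rule continuous_on_compose)
    show "continuous_on ({0..h} \<times> UNIV) (\<lambda>z. (fst z, p (snd z)))"
      by (intro continuous_intros continuous_on_compose2[OF p_cont]) auto
    show "continuous_on ((\<lambda>z. (fst z, p (snd z))) ` ({0..h} \<times> UNIV)) (\<lambda>(t, y). f t y)"
      by (rule continuous_on_subset[OF f_cont]) (use h(2) p_in in \<open>auto simp: C_def\<close>)
  qed
  then have g_cont: "continuous_on ({0..h} \<times> UNIV) (\<lambda>(s, y). g s y)"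
    by (simp add: g_def o_def case_prod_beta)
  have g_bound: "norm (g s y) \<le> K" if "s \<in> {0..h}" for s y
    using K0[of s "p y"] that h(2) p_in unfolding g_def K_def by fastforce
  have g_lip: "norm (g s y - g s z) \<le> L' * norm (y - z)" if "s \<in> {0..h}" for s y z
  proof -
    have "norm (g s y - g s z) \<le> L * norm (p y - p z)"
      unfolding g_def using f_lip[of s "p y" "p z"] that h(2) p_in by (auto simp: C_def)
    also have "\<dots> \<le> L' * norm (y - z)"
      unfolding L'_def using p_lip[of y z] 
      by (smt (verit) mult_left_mono mult_right_mono norm_ge_zero abs_ge_self)
    finally show ?thesis .
  qed
  obtain y where y0: "y 0 = y0"
    and y_speed: "\<And>t. t \<in> {0..h} \<Longrightarrow> norm (y t - y0) \<le> K * t"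
    and y_deriv: "\<And>t. t \<in> {0..h} \<Longrightarrow> (y has_vector_derivative g t (y t)) (at t within {0..h})"
    using bounded_lipschitz_ode_solvable[OF h(1) _ h(4) g_cont g_bound g_lip] \<open>0 < L'\<close> by auto
  have y_in: "y t \<in> C" if "t \<in> {0..h}" for t
  proof -
    have "K * t \<le> K * h" using that \<open>0 < K\<close> by (intro mult_left_mono) auto
    then have "norm (y t - y0) \<le> R" using y_speed[OF that] h(3) by (simp add: mult.commute)
    then show ?thesis by (simp add: C_def dist_norm norm_minus_commute)
  qed
  show thesis
  proof (rule that[of h y, OF h(1,2) y0])
    fix t assume t: "t \<in> {0..h}"
    show "y t \<in> cball y0 R" using y_in[OF t] by (simp add: C_def)
    show "(y has_vector_derivative f t (y t)) (at t within {0..h})"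
      using y_deriv[OF t] p_id[OF y_in[OF t]] by (simp add: g_def)
  qed
qed

lemma bounded_bilinear_matrix_matrix_mult:
  "bounded_bilinear
     ((**) :: 'a::{real_normed_field,euclidean_space}^'n^'m \<Rightarrow> 'a^'p^'n \<Rightarrow> 'a^'p^'m)"
  unfolding bilinear_conv_bounded_bilinear[symmetric] bilinear_def
  by (auto intro!: linearI simp: matrix_add_ldistrib matrix_scalar_ac scalar_matrix_assoc
      matrix_matrix_mult_def vec_eq_iff distrib_left distrib_right sum.distrib scaleR_sum_right)

lemma bounded_linear_transpose:
  "bounded_linear (transpose :: 'a::euclidean_space^'n^'m \<Rightarrow> 'a^'m^'n)"
  unfolding linear_conv_bounded_linear[symmetric]
  by (auto intro!: linearI simp: transpose_def vec_eq_iff)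

lemma bounded_linear_axis:
  "bounded_linear (axis i :: 'a::euclidean_space \<Rightarrow> 'a^'n)"
  unfolding linear_conv_bounded_linear[symmetric]
  by (auto intro!: linearI simp: axis_def vec_eq_iff)

lemma has_vector_derivative_vec_lambda:
  fixes f :: "real \<Rightarrow> 'a::euclidean_space^'n"
  assumes "\<And>i. ((\<lambda>t. f t $ i) has_vector_derivative f' $ i) F"
  shows "(f has_vector_derivative f') F"
proof -
  have "((\<lambda>t. \<Sum>i\<in>UNIV. axis i (f t $ i)) has_vector_derivative (\<Sum>i\<in>UNIV. axis i (f' $ i))) F"
    by (intro has_vector_derivative_sum bounded_linear.has_vector_derivative[OF bounded_linear_axis]
        assms)
  moreover have "(\<Sum>i\<in>UNIV. axis i (x $ i)) = x" for x :: "'a^'n"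
    by (simp add: vec_eq_iff sum_component axis_def)
  ultimately show ?thesis by simp
qed

lemma continuous_on_det:
  fixes X :: "real \<Rightarrow> 'a::real_normed_field^'n^'n"
  assumes "continuous_on S X"
  shows "continuous_on S (\<lambda>t. det (X t))"
proof -
  have entries: "continuous_on S (\<lambda>t. X t $ i $ j)" for i j
    by (intro bounded_linear.continuous_on[OF bounded_linear_vec_nth] assms)
  show ?thesis
    unfolding det_def by (intro continuous_intros entries)
qed

lemma rank_mul_le_right_gen:
  fixes A :: "'a::field^'n^'m" and B :: "'a^'p^'n"
  shows "rank (A ** B) \<le> rank B"
proof -
  have "rows (A ** B) \<subseteq> vec.span (rows B)"
  proof
    fix r assume "r \<in> rows (A ** B)"
    then obtain i where r: "r = row i (A ** B)" by (auto simp: rows_def)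
    have "r = (\<Sum>k\<in>UNIV. A $ i $ k *s row k B)"
      unfolding r row_def matrix_matrix_mult_def by (simp add: vec_eq_iff sum_component)
    also have "\<dots> \<in> vec.span (rows B)"
      by (intro vec.span_sum vec.span_scale vec.span_base) (auto simp: rows_def)
    finally show "r \<in> vec.span (rows B)" .
  qed
  then show ?thesis unfolding row_rank_def_gen by (rule vec.dim_mono)
qed

lemma rank_mul_le_left_gen:
  fixes A :: "'a::field^'n^'m" and B :: "'a^'p^'n"
  shows "rank (A ** B) \<le> rank A"
proof -
  have "row i (A ** B) = transpose B *v row i A" for i
    by (simp add: row_def matrix_matrix_mult_def matrix_vector_mult_def transpose_def vec_eq_iff
        mult.commute)
  then have "rows (A ** B) = (\<lambda>r. transpose B *v r) ` rows A"
    unfolding rows_def by auto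
  moreover have "vec.dim ((\<lambda>r. transpose B *v r) ` rows A) \<le> vec.dim (rows A)"
    by (rule vec.dim_image_le) (rule matrix_vector_mul_linear_gen)
  ultimately show ?thesis unfolding row_rank_def_gen by simp
qed

lemma rank_congruent_le: "rank (transpose S ** P ** S) \<le> rank (P :: 'a::field^'n^'n)"
  using rank_mul_le_left_gen[of "transpose S ** P" S] rank_mul_le_right_gen[of "transpose S" P]
  by linarith

lemma linear_matrix_ode_local_existence:
  fixes A :: "real \<Rightarrow> 'a::{real_normed_field,euclidean_space}^'n^'n" and X0 :: "'a^'n^'n"
  assumes "0 < h" and A_cont: "continuous_on {0..h} A"
  obtains h' X where "0 < h'" "h' \<le> h" "X 0 = X0"
    "\<And>t. t \<in> {0..h'} \<Longrightarrow> (X has_vector_derivative A t ** X t) (at t within {0..h'})"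
proof -
  interpret mult: bounded_bilinear "(**) :: 'a^'n^'n \<Rightarrow> 'a^'n^'n \<Rightarrow> 'a^'n^'n"
    by (rule bounded_bilinear_matrix_matrix_mult)
  obtain K where K: "\<And>(X :: 'a^'n^'n) (Y :: 'a^'n^'n). norm (X ** Y) \<le> norm X * norm Y * K"
    and "0 < K"
    using mult.pos_bounded by blast
  obtain B where B: "\<forall>t\<in>{0..h}. norm (A t) \<le> B"
    using compact_imp_bounded[OF compact_continuous_image[OF A_cont compact_Icc]]
    by (auto simp: bounded_iff)
  have "continuous_on ({0..h} \<times> cball X0 1) (\<lambda>p. A (fst p))"
    by (rule continuous_on_compose2[OF A_cont continuous_on_fst]) auto
  then have cont: "continuous_on ({0..h} \<times> cball X0 1) (\<lambda>(t, X). A t ** X)"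
    unfolding case_prod_beta by (rule mult.continuous_on[OF _ continuous_on_snd]) auto
  show thesis
  proof (rule ode_local_existence[OF \<open>0 < h\<close> zero_less_one cont])
    fix t and X Y :: "'a^'n^'n"
    assume "t \<in> {0..h}"
    have "norm (A t ** X - A t ** Y) \<le> norm (A t) * norm (X - Y) * K"
      using K[of "A t" "X - Y"] by (simp add: mult.diff_right)
    also have "\<dots> \<le> B * norm (X - Y) * K"
      using B \<open>t \<in> {0..h}\<close> \<open>0 < K\<close> by (intro mult_right_mono) auto
    finally show "norm (A t ** X - A t ** Y) \<le> (B * K) * norm (X - Y)"
      by (simp add: mult_ac)
  qed (rule that)
qed

lemma differential_lyapunov_congruent:
  fixes P M :: "real \<Rightarrow> 'a::{real_normed_field,euclidean_space}^'n^'n"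
  assumes "0 < h" and M_cont: "continuous_on {0..h} M"
    and P_deriv: "\<And>t. t \<in> {0..h} \<Longrightarrow>
      (P has_vector_derivative M t ** P t + P t ** transpose (M t)) (at t within {0..h})"
  obtains h' where "0 < h'" "h' \<le> h" "\<And>t. t \<in> {0..h'} \<Longrightarrow> \<exists>S. P t = transpose S ** P 0 ** S"
proof -
  interpret mult: bounded_bilinear "(**) :: 'a^'n^'n \<Rightarrow> 'a^'n^'n \<Rightarrow> 'a^'n^'n"
    by (rule bounded_bilinear_matrix_matrix_mult)
  interpret tr: bounded_linear "transpose :: 'a^'n^'n \<Rightarrow> 'a^'n^'n"
    by (rule bounded_linear_transpose)
  have "continuous_on {0..h} (\<lambda>t. - transpose (M t))"
    by (intro continuous_intros tr.continuous_on M_cont)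
  then obtain h1 X where "0 < h1" "h1 \<le> h" and X0: "X 0 = mat 1"
    and X_deriv: "\<And>t. t \<in> {0..h1} \<Longrightarrow>
      (X has_vector_derivative - transpose (M t) ** X t) (at t within {0..h1})"
    using linear_matrix_ode_local_existence[OF \<open>0 < h\<close>, of "\<lambda>t. - transpose (M t)" "mat 1"]
    by blast
  have "((\<lambda>t. transpose (X t) ** P t ** X t) has_derivative (\<lambda>_. 0)) (at t within {0..h1})"
    if t: "t \<in> {0..h1}" for t
  proof -
    have "(P has_vector_derivative M t ** P t + P t ** transpose (M t)) (at t within {0..h1})"
      by (rule has_vector_derivative_within_subset[OF P_deriv]) (use t \<open>h1 \<le> h\<close> in auto)
    then have "((\<lambda>t. transpose (X t) ** P t ** X t) has_vector_derivative
        transpose (X t) ** P t ** (- transpose (M t) ** X t)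
        + (transpose (X t) ** (M t ** P t + P t ** transpose (M t))
           + transpose (- transpose (M t) ** X t) ** P t) ** X t) (at t within {0..h1})"
      by (intro mult.has_vector_derivative tr.has_vector_derivative X_deriv t)
    moreover have "transpose (X t) ** P t ** (- transpose (M t) ** X t)
        + (transpose (X t) ** (M t ** P t + P t ** transpose (M t))
           + transpose (- transpose (M t) ** X t) ** P t) ** X t = 0"
      by (simp add: matrix_transpose_mul tr.neg mult.add_left mult.add_right mult.minus_left
          mult.minus_right matrix_mul_assoc)
    ultimately show ?thesis
      unfolding has_vector_derivative_def by simp
  qed
  then obtain Q where Q: "\<forall>t\<in>{0..h1}. transpose (X t) ** P t ** X t = Q"
    using has_derivative_zero_constant[of "{0..h1}" "\<lambda>t. transpose (X t) ** P t ** X t"] by auto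
  have congruence: "transpose (X t) ** P t ** X t = P 0" if "t \<in> {0..h1}" for t
  proof -
    have "transpose (X t) ** P t ** X t = transpose (X 0) ** P 0 ** X 0"
      using Q that \<open>0 < h1\<close> by simp
    then show ?thesis by (simp add: X0)
  qed
  have "continuous_on {0..h1} X"
    using X_deriv has_vector_derivative_continuous continuous_on_eq_continuous_within by blast
  then have "continuous_on {0..h1} (\<lambda>t. det (X t))"
    by (rule continuous_on_det)
  then obtain d where "0 < d"
    and d: "\<And>t. t \<in> {0..h1} \<Longrightarrow> dist t 0 < d \<Longrightarrow> dist (det (X t)) (det (X 0)) < 1"
    using \<open>0 < h1\<close> unfolding continuous_on_iff
    by (metis atLeastAtMost_iff less_eq_real_def order_refl zero_less_one)
  show thesis
  proof (rule that[of "min h1 (d / 2)"])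
    show "0 < min h1 (d / 2)" using \<open>0 < h1\<close> \<open>0 < d\<close> by simp
    show "min h1 (d / 2) \<le> h" using \<open>h1 \<le> h\<close> by simp
    fix t assume t: "t \<in> {0..min h1 (d / 2)}"
    then have t1: "t \<in> {0..h1}" by simp
    have "dist (det (X t)) (det (X 0)) < 1"
      using d[OF t1] t \<open>0 < d\<close> by (simp add: dist_real_def)
    then have "det (X t) \<noteq> 0"
      by (auto simp: X0 det_I)
    then obtain Y where XY: "X t ** Y = mat 1"
      using invertible_det_nz invertible_def by blast
    then have YX: "transpose Y ** transpose (X t) = mat 1"
      by (metis matrix_transpose_mul transpose_mat)
    have "transpose Y ** P 0 ** Y = transpose Y ** (transpose (X t) ** P t ** X t) ** Y"
      by (simp add: congruence[OF t1])
    also have "\<dots> = (transpose Y ** transpose (X t)) ** P t ** (X t ** Y)"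
      by (simp add: matrix_mul_assoc)
    finally show "\<exists>S. P t = transpose S ** P 0 ** S"
      unfolding XY YX by (intro exI[of _ Y]) simp
  qed
qed

definition has_continuous_partials_on :: "('a::real_normed_field^'n) set \<Rightarrow> ('a^'n \<Rightarrow> 'a) \<Rightarrow> bool"
  where "has_continuous_partials_on U f \<longleftrightarrow>
    (\<forall>x\<in>U. (f has_derivative (\<lambda>v. \<Sum>l\<in>UNIV. v $ l * pd f x l)) (at x)) \<and>
    (\<forall>l. continuous_on U (\<lambda>x. pd f x l))"

lemma pd_eqI:
  assumes "(f has_derivative (\<lambda>v. \<Sum>l\<in>UNIV. v $ l * d l)) (at x)"
  shows "pd f x l = d l"
proof -
  have "pd f x l = (\<Sum>m\<in>UNIV. axis l 1 $ m * d m)"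
    unfolding pd_def frechet_derivative_at[OF assms, symmetric] ..
  also have "\<dots> = (\<Sum>m\<in>UNIV. if m = l then d m else 0)"
    by (rule sum.cong) (auto simp: axis_def)
  finally show ?thesis by simp
qed

lemma has_continuous_partials_on_add_scaled:
  assumes f: "has_continuous_partials_on U f" and g: "has_continuous_partials_on U g"
  shows "has_continuous_partials_on U (\<lambda>y. f y + c * g y)"
    and "x \<in> U \<Longrightarrow> pd (\<lambda>y. f y + c * g y) x l = pd f x l + c * pd g x l"
proof -
  have deriv: "((\<lambda>y. f y + c * g y) has_derivative
      (\<lambda>v. \<Sum>l\<in>UNIV. v $ l * (pd f x l + c * pd g x l))) (at x)" if "x \<in> U" for x
  proof -
    have "((\<lambda>y. f y + c * g y) has_derivative
        (\<lambda>v. (\<Sum>l\<in>UNIV. v $ l * pd f x l) + c * (\<Sum>l\<in>UNIV. v $ l * pd g x l))) (at x)"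
      using f g that unfolding has_continuous_partials_on_def
      by (intro has_derivative_add has_derivative_mult_right) auto
    then show ?thesis
      by (simp add: distrib_left sum.distrib sum_distrib_left mult_ac)
  qed
  have pd_eq: "pd (\<lambda>y. f y + c * g y) x l = pd f x l + c * pd g x l" if "x \<in> U" for x l
    using deriv[OF that] by (rule pd_eqI)
  then show "x \<in> U \<Longrightarrow> pd (\<lambda>y. f y + c * g y) x l = pd f x l + c * pd g x l" .
  show "has_continuous_partials_on U (\<lambda>y. f y + c * g y)"
    unfolding has_continuous_partials_on_def
  proof (intro conjI ballI allI)
    show "((\<lambda>y. f y + c * g y) has_derivative
        (\<lambda>v. \<Sum>l\<in>UNIV. v $ l * pd (\<lambda>y. f y + c * g y) x l)) (at x)" if "x \<in> U" for x
      using deriv[OF that] by (simp add: pd_eq[OF that])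
    show "continuous_on U (\<lambda>x. pd (\<lambda>y. f y + c * g y) x l)" for l
      using f g unfolding has_continuous_partials_on_def
      by (auto intro!: continuous_intros simp: pd_eq cong: continuous_on_cong)
  qed
qed

lemma smooth_on_has_continuous_partials:
  fixes f :: "real^'n \<Rightarrow> real"
  assumes "open U" "smooth_on U f"
  shows "has_continuous_partials_on U f"
proof -
  obtain D :: "'n list \<Rightarrow> real^'n \<Rightarrow> real" where D0: "\<And>x. x \<in> U \<Longrightarrow> D [] x = f x"
    and D: "\<And>ds x. x \<in> U \<Longrightarrow> (D ds has_derivative (\<lambda>v. \<Sum>i\<in>UNIV. v $ i * D (i # ds) x)) (at x)"
    using assms(2) unfolding smooth_on_def by blast
  have f_deriv: "(f has_derivative (\<lambda>v. \<Sum>i\<in>UNIV. v $ i * D [i] x)) (at x)" if "x \<in> U" for x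
    by (rule has_derivative_transform_within_open[OF D[OF that] assms(1) that]) (simp add: D0)
  have pd_eq: "pd f x l = D [l] x" if "x \<in> U" for x l
    by (rule pd_eqI[OF f_deriv[OF that]])
  have "continuous_on U (D [l])" for l
    using D by (auto intro!: continuous_at_imp_continuous_on has_derivative_continuous)
  then show ?thesis
    unfolding has_continuous_partials_on_def
    using f_deriv by (simp add: pd_eq cong: continuous_on_cong)
qed

lemma complex_linear_derivative_partials:
  fixes f :: "complex^'n \<Rightarrow> complex"
  assumes f': "(f has_derivative f') (at x)" and lin: "\<And>c v. f' (c *s v) = c * f' v"
  shows "pd f x l = f' (axis l 1)"
    and "(f has_derivative (\<lambda>v. \<Sum>l\<in>UNIV. v $ l * pd f x l)) (at x)"
proof -
  have pd: "pd f x l = f' (axis l 1)" for l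
    unfolding pd_def using frechet_derivative_at[OF f'] by simp
  then show "pd f x l = f' (axis l 1)" .
  have "f' v = (\<Sum>l\<in>UNIV. v $ l * pd f x l)" for v
  proof -
    have "f' v = f' (\<Sum>l\<in>UNIV. v $ l *s axis l 1)"
      by (simp add: basis_expansion)
    also have "\<dots> = (\<Sum>l\<in>UNIV. f' (v $ l *s axis l 1))"
      by (rule linear_sum[OF has_derivative_linear[OF f']])
    finally show ?thesis by (simp add: lin pd)
  qed
  then have "f' = (\<lambda>v. \<Sum>l\<in>UNIV. v $ l * pd f x l)" ..
  then show "(f has_derivative (\<lambda>v. \<Sum>l\<in>UNIV. v $ l * pd f x l)) (at x)"
    using f' by simp
qed

lemma norm_axis: "norm (axis i x :: 'a::real_normed_vector^'n) = norm x"
  by (simp add: norm_vec_def L2_set_def axis_def if_distrib[of norm] if_distrib[of "\<lambda>a. a ^ 2"]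
      cong: if_cong)

lemma holo_on_has_field_derivative_axis:
  fixes f :: "complex^'n \<Rightarrow> complex"
  assumes "holo_on U f" "z + axis l w \<in> U"
  shows "((\<lambda>w. f (z + axis l w)) has_field_derivative pd f (z + axis l w) l) (at w)"
proof -
  obtain f' where f': "(f has_derivative f') (at (z + axis l w))"
    and lin: "\<And>c v. f' (c *s v) = c * f' v"
    using assms unfolding holo_on_def by blast
  have "((\<lambda>w. z + axis l w) has_derivative axis l) (at w)"
    using has_derivative_add[OF has_derivative_const
        bounded_linear_imp_has_derivative[OF bounded_linear_axis]] by simp
  from has_derivative_compose[OF this f']
  have "((\<lambda>w. f (z + axis l w)) has_derivative (\<lambda>c. f' (axis l c))) (at w)" .
  moreover have "(\<lambda>c. f' (axis l c)) = (*) (f' (axis l 1))"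
  proof
    fix c
    have "axis l c = c *s (axis l 1 :: complex^'n)"
      by (simp add: axis_def vec_eq_iff)
    then show "f' (axis l c) = f' (axis l 1) * c"
      using lin[of c "axis l 1"] by (simp add: mult.commute)
  qed
  ultimately show ?thesis
    unfolding has_field_derivative_def complex_linear_derivative_partials(1)[OF f' lin]
    by simp
qed

lemma holo_on_continuous_on_pd:
  fixes f :: "complex^'n \<Rightarrow> complex"
  assumes "open U" and holo: "holo_on U f"
  shows "continuous_on U (\<lambda>x. pd f x l)"
proof (rule continuous_at_imp_continuous_on, rule ballI)
  fix x0 assume "x0 \<in> U"
  then obtain r0 where "0 < r0" "cball x0 r0 \<subseteq> U"
    using \<open>open U\<close> open_contains_cball by blast
  define r where "r = r0 / 2"
  have "0 < r" and K_sub: "cball x0 (2 * r) \<subseteq> U"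
    using \<open>0 < r0\<close> \<open>cball x0 r0 \<subseteq> U\<close> by (simp_all add: r_def)
  define K where "K = cball x0 (2 * r)"
  have "continuous_on K f"
    using holo K_sub unfolding K_def holo_on_def
    by (auto intro!: continuous_at_imp_continuous_on dest: has_derivative_continuous)
  then have unif: "uniformly_continuous_on K f"
    by (rule compact_uniformly_continuous) (simp add: K_def)
  have line_in_K: "x + axis l w \<in> K" if "dist x x0 < r" "norm w \<le> r" for x w
  proof -
    have "dist x0 (x + axis l w) \<le> dist x0 x + norm w"
      using dist_triangle[of x0 "x + axis l w" x] by (simp add: dist_norm norm_axis)
    then show ?thesis
      using that by (simp add: K_def dist_commute norm_axis)
  qed
  show "isCont (\<lambda>x. pd f x l) x0"
    unfolding continuous_at_eps_delta
  proof (intro allI impI)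
    fix e :: real assume "0 < e"
    then have "0 < e * r / 2" using \<open>0 < r\<close> by simp
    then obtain \<delta> where "0 < \<delta>" and \<delta>:
      "\<And>p q. p \<in> K \<Longrightarrow> q \<in> K \<Longrightarrow> dist p q < \<delta> \<Longrightarrow> dist (f p) (f q) < e * r / 2"
      using unif unfolding uniformly_continuous_on_def by blast
    show "\<exists>d>0. \<forall>z. dist z x0 < d \<longrightarrow> dist (pd f z l) (pd f x0 l) < e"
    proof (intro exI[of _ "min r \<delta>"] conjI allI impI)
      show "0 < min r \<delta>" using \<open>0 < r\<close> \<open>0 < \<delta>\<close> by simp
      fix z assume z: "dist z x0 < min r \<delta>"
      define \<phi> where "\<phi> w = f (z + axis l w) - f (x0 + axis l w)" for w
      have \<phi>_deriv: "(\<phi> has_field_derivative pd f (z + axis l w) l - pd f (x0 + axis l w) l) (at w)"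
        if "norm w \<le> r" for w
        unfolding \<phi>_def using that z \<open>0 < r\<close> K_sub line_in_K
        by (intro derivative_intros holo_on_has_field_derivative_axis[OF holo]) (auto simp: K_def)
      have "norm ((deriv ^^ 1) \<phi> 0) \<le> fact 1 * (e * r / 2) / r ^ 1"
      proof (rule Cauchy_inequality[OF _ _ \<open>0 < r\<close>])
        show "\<phi> holomorphic_on ball 0 r"
          unfolding holomorphic_on_def field_differentiable_def
        proof
          fix w :: complex assume "w \<in> ball 0 r"
          then have "norm w \<le> r" by simp
          then show "\<exists>D. (\<phi> has_field_derivative D) (at w within ball 0 r)"
            using \<phi>_deriv has_field_derivative_at_within by blast
        qed
        show "continuous_on (cball 0 r) \<phi>"
          using \<phi>_deriv by (auto intro!: continuous_at_imp_continuous_on DERIV_isCont)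
        fix w :: complex assume "norm (0 - w) = r"
        then have "dist (f (z + axis l w)) (f (x0 + axis l w)) < e * r / 2"
          using z by (intro \<delta> line_in_K) (auto simp: dist_norm)
        then show "norm (\<phi> w) \<le> e * r / 2"
          by (simp add: \<phi>_def dist_norm)
      qed
      moreover have "deriv \<phi> 0 = pd f z l - pd f x0 l"
      proof -
        have axis0: "axis l 0 = (0 :: complex^'n)"
          by (simp add: axis_def vec_eq_iff)
        show ?thesis
          using DERIV_imp_deriv[OF \<phi>_deriv[of 0]] \<open>0 < r\<close> unfolding axis0 by simp
      qed
      ultimately show "dist (pd f z l) (pd f x0 l) < e"
        using \<open>0 < r\<close> \<open>0 < e\<close> by (simp add: dist_norm)
    qed
  qed
qed

lemma holo_on_has_continuous_partials:
  assumes "open U" "holo_on U f"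
  shows "has_continuous_partials_on U f"
  unfolding has_continuous_partials_on_def
  using assms holo_on_continuous_on_pd complex_linear_derivative_partials(2)
  unfolding holo_on_def by blast

lemma lipschitz_bounded_partials:
  fixes g :: "'a::real_normed_field^'n \<Rightarrow> 'a"
  assumes "convex S"
    and g: "\<And>x. x \<in> S \<Longrightarrow> (g has_derivative (\<lambda>v. \<Sum>l\<in>UNIV. v $ l * pd g x l)) (at x)"
    and C: "\<And>x l. x \<in> S \<Longrightarrow> norm (pd g x l) \<le> C"
    and "x \<in> S" "y \<in> S"
  shows "norm (g x - g y) \<le> (real CARD('n) * C) * norm (x - y)"
proof (rule differentiable_bound[OF \<open>convex S\<close> _ _ \<open>x \<in> S\<close> \<open>y \<in> S\<close>])
  fix z assume "z \<in> S"
  show "(g has_derivative (\<lambda>v. \<Sum>l\<in>UNIV. v $ l * pd g z l)) (at z within S)"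
    using g[OF \<open>z \<in> S\<close>] by (rule has_derivative_at_withinI)
  show "onorm (\<lambda>v. \<Sum>l\<in>UNIV. v $ l * pd g z l) \<le> real CARD('n) * C"
  proof (rule onorm_le)
    fix v :: "'a^'n"
    have "norm (\<Sum>l\<in>UNIV. v $ l * pd g z l) \<le> (\<Sum>l\<in>UNIV. norm (v $ l) * norm (pd g z l))"
      by (rule order_trans[OF norm_sum]) (simp add: norm_mult)
    also have "\<dots> \<le> (\<Sum>l\<in>(UNIV::'n set). norm v * C)"
      using C[OF \<open>z \<in> S\<close>] by (intro sum_mono mult_mono Finite_Cartesian_Product.norm_nth_le) auto
    finally show "norm (\<Sum>l\<in>UNIV. v $ l * pd g z l) \<le> real CARD('n) * C * norm v"
      by (simp add: mult_ac)
  qed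
qed

lemma integral_curve_exists:
  fixes X :: "'a::{real_normed_field,euclidean_space}^'n \<Rightarrow> 'a^'n"
  assumes "open U" "x0 \<in> U" and X: "\<And>a. has_continuous_partials_on U (\<lambda>y. X y $ a)"
  obtains h \<gamma> where "0 < h" "\<gamma> 0 = x0" "\<And>t. t \<in> {0..h} \<Longrightarrow> \<gamma> t \<in> U"
    "\<And>t. t \<in> {0..h} \<Longrightarrow> (\<gamma> has_vector_derivative X (\<gamma> t)) (at t within {0..h})"
proof -
  obtain R where "0 < R" and R: "cball x0 R \<subseteq> U"
    using assms(1,2) open_contains_cball by blast
  have X_deriv: "((\<lambda>y. X y $ a) has_derivative (\<lambda>v. \<Sum>l\<in>UNIV. v $ l * pd (\<lambda>y. X y $ a) y l)) (at y)"
    if "y \<in> U" for y a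
    using X that unfolding has_continuous_partials_on_def by blast
  define G where "G y = (\<Sum>a\<in>UNIV. \<Sum>l\<in>UNIV. norm (pd (\<lambda>y. X y $ a) y l))" for y
  have "continuous_on (cball x0 R) G"
    unfolding G_def using X R unfolding has_continuous_partials_on_def
    by (intro continuous_intros) (blast intro: continuous_on_subset)
  then have "bounded (G ` cball x0 R)"
    by (intro compact_imp_bounded compact_continuous_image) auto
  then obtain C where C: "\<forall>y\<in>cball x0 R. norm (G y) \<le> C"
    by (auto simp: bounded_iff)
  have partial_le: "norm (pd (\<lambda>y. X y $ a) y l) \<le> C" if "y \<in> cball x0 R" for y a l
  proof -
    have "norm (pd (\<lambda>y. X y $ a) y l) \<le> (\<Sum>l\<in>UNIV. norm (pd (\<lambda>y. X y $ a) y l))"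
      by (rule member_le_sum) auto
    also have "\<dots> \<le> G y"
      unfolding G_def by (rule member_le_sum) (auto intro: sum_nonneg)
    also have "\<dots> \<le> C"
    proof -
      have "\<bar>G y\<bar> \<le> C" using C that by auto
      then show ?thesis by linarith
    qed
    finally show ?thesis .
  qed
  have cont: "continuous_on ({0..1::real} \<times> cball x0 R) (\<lambda>(t, y). X y)"
  proof -
    have "continuous_on U (\<lambda>y. X y $ a)" for a
      by (auto intro!: continuous_at_imp_continuous_on intro: has_derivative_continuous[OF X_deriv])
    then have "continuous_on U (\<lambda>y. \<chi> a. X y $ a)"
      by (rule continuous_on_vec_lambda)
    then have "continuous_on U X" by simp
    then show ?thesis
      unfolding case_prod_beta by (rule continuous_on_compose2[OF _ continuous_on_snd]) (use R in auto)
  qed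
  show thesis
  proof (rule ode_local_existence[OF zero_less_one \<open>0 < R\<close> cont])
    fix t y z
    assume "y \<in> cball x0 R" "z \<in> cball x0 R"
    have "norm (X y - X z) \<le> (\<Sum>a\<in>UNIV. norm (X y $ a - X z $ a))"
      unfolding norm_vec_def by (rule order_trans[OF L2_set_le_sum]) simp_all
    also have "\<dots> \<le> (\<Sum>a\<in>(UNIV::'n set). (real CARD('n) * C) * norm (y - z))"
      using R \<open>y \<in> cball x0 R\<close> \<open>z \<in> cball x0 R\<close>
      by (intro sum_mono lipschitz_bounded_partials[OF convex_cball _ partial_le])
        (auto intro: X_deriv)
    finally show "norm (X y - X z) \<le> (real CARD('n) * (real CARD('n) * C)) * norm (y - z)"
      by simp
  next
    fix h \<gamma>
    assume "0 < h" "h \<le> 1" "\<gamma> 0 = x0" "\<And>t. t \<in> {0..h} \<Longrightarrow> \<gamma> t \<in> cball x0 R"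
      "\<And>t. t \<in> {0..h} \<Longrightarrow> (\<gamma> has_vector_derivative X (\<gamma> t)) (at t within {0..h})"
    then show thesis
      using R by (intro that[of h \<gamma>]) auto
  qed
qed

lemma has_vector_derivative_chain_partials:
  fixes g :: "'a::real_normed_field^'n \<Rightarrow> 'a"
  assumes "(\<gamma> has_vector_derivative v) (at t within S)"
    and "(g has_derivative (\<lambda>w. \<Sum>l\<in>UNIV. w $ l * pd g (\<gamma> t) l)) (at (\<gamma> t))"
  shows "((\<lambda>s. g (\<gamma> s)) has_vector_derivative (\<Sum>l\<in>UNIV. v $ l * pd g (\<gamma> t) l)) (at t within S)"
  using vector_derivative_diff_chain_within[OF assms(1) has_derivative_at_withinI[OF assms(2)]]
  by (simp add: o_def)

definition jacobiator :: "'a::comm_ring^'n^'n \<Rightarrow> ('n \<Rightarrow> 'n \<Rightarrow> 'n \<Rightarrow> 'a) \<Rightarrow> 'n \<Rightarrow> 'n \<Rightarrow> 'n \<Rightarrow> 'a"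
  where "jacobiator P dP i j k =
    (\<Sum>l\<in>UNIV. P $ i $ l * dP l j k + P $ j $ l * dP l k i + P $ k $ l * dP l i j)"

definition partials :: "('a::real_normed_field^'n \<Rightarrow> 'a^'n^'n) \<Rightarrow> 'a^'n \<Rightarrow> 'n \<Rightarrow> 'n \<Rightarrow> 'n \<Rightarrow> 'a"
  where "partials P x l a b = pd (\<lambda>y. P y $ a $ b) x l"

definition jacobian :: "('a::real_normed_field^'n \<Rightarrow> 'a^'m) \<Rightarrow> 'a^'n \<Rightarrow> 'a^'n^'m"
  where "jacobian F x = (\<chi> a l. pd (\<lambda>y. F y $ a) x l)"

lemma poisson_on_iff_jacobiator:
  "poisson_on U P \<longleftrightarrow> (\<forall>x\<in>U. (\<forall>i j. P x $ i $ j = - P x $ j $ i) \<and>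
     (\<forall>i j k. jacobiator (P x) (partials P x) i j k = 0))"
  unfolding poisson_on_def jacobiator_def partials_def ..

lemma poisson_on_skew: "poisson_on U P \<Longrightarrow> x \<in> U \<Longrightarrow> P x $ i $ j = - P x $ j $ i"
  unfolding poisson_on_def by blast

lemma poisson_on_jacobiator:
  "poisson_on U P \<Longrightarrow> x \<in> U \<Longrightarrow> jacobiator (P x) (partials P x) i j k = 0"
  unfolding poisson_on_iff_jacobiator by blast

lemma jacobiator_add_scaled:
  "jacobiator (\<chi> a b. P $ a $ b + s * Q $ a $ b) (\<lambda>l a b. dP l a b + s * dQ l a b) i j k
   = jacobiator P dP i j k + s * (jacobiator P dQ i j k + jacobiator Q dP i j k)
     + s * s * jacobiator Q dQ i j k"
  unfolding jacobiator_def by (simp add: algebra_simps sum.distrib sum_distrib_left)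

lemma poisson_on_pencil_member:
  fixes A B :: "'a::real_normed_field^'n \<Rightarrow> 'a^'n^'n"
  assumes pencil: "poisson_pencil_on U A B"
    and A: "\<And>i j. has_continuous_partials_on U (\<lambda>x. A x $ i $ j)"
    and B: "\<And>i j. has_continuous_partials_on U (\<lambda>x. B x $ i $ j)"
  shows "poisson_on U (\<lambda>x. \<chi> i j. A x $ i $ j - c * B x $ i $ j)"
  unfolding poisson_on_iff_jacobiator
proof (intro ballI conjI allI)
  fix x i j k assume "x \<in> U"
  have pd_comb: "partials (\<lambda>x. \<chi> i j. A x $ i $ j + s * B x $ i $ j) x
      = (\<lambda>l a b. partials A x l a b + s * partials B x l a b)" for s
    using has_continuous_partials_on_add_scaled(2)[OF A B \<open>x \<in> U\<close>]
    by (simp add: partials_def fun_eq_iff)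
  have AB_eq: "(\<lambda>x. A x + B x) = (\<lambda>x. \<chi> i j. A x $ i $ j + 1 * B x $ i $ j)"
    by (simp add: fun_eq_iff vec_eq_iff)
  have pA: "poisson_on U A" and pB: "poisson_on U B"
    and pAB: "poisson_on U (\<lambda>x. \<chi> i j. A x $ i $ j + 1 * B x $ i $ j)"
    using pencil unfolding poisson_pencil_on_def AB_eq by auto
  note J = poisson_on_jacobiator[OF pA \<open>x \<in> U\<close>] poisson_on_jacobiator[OF pB \<open>x \<in> U\<close>]
    poisson_on_jacobiator[OF pAB \<open>x \<in> U\<close>, unfolded pd_comb]
    \<comment> \<open>compatibility kills the mixed term, so the Jacobi identity is quadratic-free in the pencil parameter\<close>
  have "jacobiator (\<chi> a b. A x $ a $ b + (- c) * B x $ a $ b)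
      (\<lambda>l a b. partials A x l a b + (- c) * partials B x l a b) i j k = 0"
    using J unfolding jacobiator_add_scaled by simp
  then show "jacobiator ((\<lambda>x. \<chi> i j. A x $ i $ j - c * B x $ i $ j) x)
      (partials (\<lambda>x. \<chi> i j. A x $ i $ j - c * B x $ i $ j) x) i j k = 0"
    using pd_comb[of "- c"] by simp
  have "A x $ i $ j = - A x $ j $ i" "B x $ i $ j = - B x $ j $ i"
    using pencil \<open>x \<in> U\<close> unfolding poisson_pencil_on_def by (blast intro: poisson_on_skew)+
  then show "(\<chi> i j. A x $ i $ j - c * B x $ i $ j) $ i $ j
      = - (\<chi> i j. A x $ i $ j - c * B x $ i $ j) $ j $ i"
    by simp
qed

lemma partials_skew:
  fixes P :: "'a::real_normed_field^'n \<Rightarrow> 'a^'n^'n"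
  assumes "open U" "x \<in> U"
    and C1: "\<And>a b. has_continuous_partials_on U (\<lambda>y. P y $ a $ b)"
    and skew: "\<And>y a b. y \<in> U \<Longrightarrow> P y $ a $ b = - P y $ b $ a"
  shows "partials P x l a b = - partials P x l b a"
proof -
  have "((\<lambda>y. - P y $ b $ a) has_derivative (\<lambda>v. - (\<Sum>l\<in>UNIV. v $ l * partials P x l b a))) (at x)"
    using C1 \<open>x \<in> U\<close> unfolding has_continuous_partials_on_def partials_def
    by (intro has_derivative_minus) auto
  then have "((\<lambda>y. - P y $ b $ a) has_derivative
      (\<lambda>v. \<Sum>l\<in>UNIV. v $ l * - partials P x l b a)) (at x)"
    by (simp add: sum_negf)
  then have "((\<lambda>y. P y $ a $ b) has_derivative
      (\<lambda>v. \<Sum>l\<in>UNIV. v $ l * - partials P x l b a)) (at x)"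
    by (rule has_derivative_transform_within_open[OF _ assms(1,2)]) (simp add: skew[of _ a b])
  then show ?thesis
    unfolding partials_def by (rule pd_eqI)
qed

lemma jacobiator_lie_derivative:
  fixes P :: "'a::comm_ring_1^'n^'n"
  assumes skew: "\<And>a b. P $ a $ b = - P $ b $ a"
    and d_skew: "\<And>l a b. d l a b = - d l b a"
    and jacobi: "jacobiator P d a b j = 0"
  shows "(\<Sum>l\<in>UNIV. P $ l $ j * d l a b)
    = ((\<chi> a l. d l a j) ** P + P ** transpose (\<chi> a l. d l a j)) $ a $ b"
proof -
  have e1: "(\<Sum>l\<in>UNIV. P $ l $ j * d l a b) = - (\<Sum>l\<in>UNIV. P $ j $ l * d l a b)"
    by (subst skew) (simp add: sum_negf)
  have e2: "(\<Sum>l\<in>UNIV. P $ b $ l * d l j a) = (\<Sum>l\<in>UNIV. d l a j * P $ l $ b)"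
    by (rule sum.cong[OF refl]) (metis d_skew skew minus_mult_minus mult.commute)
  have "(\<Sum>l\<in>UNIV. P $ a $ l * d l b j) + (\<Sum>l\<in>UNIV. P $ b $ l * d l j a)
      + (\<Sum>l\<in>UNIV. P $ j $ l * d l a b) = 0"
    using jacobi by (simp add: jacobiator_def sum.distrib)
  then have "(\<Sum>l\<in>UNIV. P $ l $ j * d l a b)
      = (\<Sum>l\<in>UNIV. d l a j * P $ l $ b + P $ a $ l * d l b j)"
    using e1 e2 by (simp add: sum.distrib add_eq_0_iff algebra_simps)
  then show ?thesis
    by (simp add: matrix_matrix_mult_def transpose_def sum.distrib)
qed

lemma poisson_hamiltonian_flow_congruent:
  fixes P :: "'a::{real_normed_field,euclidean_space}^'n \<Rightarrow> 'a^'n^'n"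
  assumes "open U" "x0 \<in> U"
    and C1: "\<And>a b. has_continuous_partials_on U (\<lambda>x. P x $ a $ b)" and "poisson_on U P"
  obtains h \<gamma> where "0 < h" "\<gamma> 0 = x0"
    "(\<gamma> has_vector_derivative column j (P x0)) (at 0 within {0..h})"
    "\<And>t. t \<in> {0..h} \<Longrightarrow> \<exists>S. P (\<gamma> t) = transpose S ** P x0 ** S"
proof -
  have P_deriv: "((\<lambda>y. P y $ a $ b) has_derivative
      (\<lambda>v. \<Sum>l\<in>UNIV. v $ l * pd (\<lambda>y. P y $ a $ b) y l)) (at y)" if "y \<in> U" for y a b
    using C1 that unfolding has_continuous_partials_on_def by blast
  have C1_column: "has_continuous_partials_on U (\<lambda>y. column j (P y) $ a)" for a
    using C1 by (simp add: column_def)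
  obtain h \<gamma> where "0 < h" "\<gamma> 0 = x0" and \<gamma>_in: "\<And>t. t \<in> {0..h} \<Longrightarrow> \<gamma> t \<in> U"
    and \<gamma>_deriv: "\<And>t. t \<in> {0..h} \<Longrightarrow>
      (\<gamma> has_vector_derivative column j (P (\<gamma> t))) (at t within {0..h})"
    using integral_curve_exists[OF assms(1,2) C1_column] by blast
  define J where "J t = jacobian (\<lambda>y. column j (P y)) (\<gamma> t)" for t
  have J_entry: "J t $ a $ l = partials P (\<gamma> t) l a j" for t a l
  proof -
    have "(\<lambda>y. column j (P y) $ a) = (\<lambda>y. P y $ a $ j)"
      by (simp add: column_def)
    then show ?thesis
      by (simp add: J_def jacobian_def partials_def)
  qed
  have \<gamma>_cont: "continuous_on {0..h} \<gamma>"
    unfolding continuous_on_eq_continuous_within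
    using \<gamma>_deriv has_vector_derivative_continuous by blast
  have partials_cont: "continuous_on U (\<lambda>y. partials P y l a b)" for a b l
    using C1 unfolding has_continuous_partials_on_def partials_def by blast
  have "continuous_on {0..h} (\<lambda>t. partials P (\<gamma> t) l a j)" for a l
    by (rule continuous_on_compose2[OF partials_cont \<gamma>_cont]) (use \<gamma>_in in auto)
  then have "continuous_on {0..h} (\<lambda>t. \<chi> a l. J t $ a $ l)"
    unfolding J_entry[symmetric] by (intro continuous_on_vec_lambda)
  then have J_cont: "continuous_on {0..h} J"
    by simp
  have "((\<lambda>t. P (\<gamma> t)) has_vector_derivative J t ** P (\<gamma> t) + P (\<gamma> t) ** transpose (J t))
      (at t within {0..h})" if "t \<in> {0..h}" for t
  proof (intro has_vector_derivative_vec_lambda)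
    fix a b
    have skew: "\<And>y a b. y \<in> U \<Longrightarrow> P y $ a $ b = - P y $ b $ a"
      by (rule poisson_on_skew[OF \<open>poisson_on U P\<close>])
    have J_eq: "J t = (\<chi> a l. partials P (\<gamma> t) l a j)"
      by (simp add: vec_eq_iff J_entry)
    have "(\<Sum>l\<in>UNIV. P (\<gamma> t) $ l $ j * partials P (\<gamma> t) l a b)
        = (J t ** P (\<gamma> t) + P (\<gamma> t) ** transpose (J t)) $ a $ b"
      unfolding J_eq using \<gamma>_in[OF that]
      by (intro jacobiator_lie_derivative skew partials_skew[OF \<open>open U\<close> _ C1 skew]
          poisson_on_jacobiator[OF \<open>poisson_on U P\<close>])
    moreover have "((\<lambda>s. P (\<gamma> s) $ a $ b) has_vector_derivative
        (\<Sum>l\<in>UNIV. P (\<gamma> t) $ l $ j * partials P (\<gamma> t) l a b)) (at t within {0..h})"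
      using has_vector_derivative_chain_partials[OF \<gamma>_deriv[OF that] P_deriv[OF \<gamma>_in[OF that]]]
      by (simp add: column_def partials_def)
    ultimately show "((\<lambda>t. P (\<gamma> t) $ a $ b) has_vector_derivative
        (J t ** P (\<gamma> t) + P (\<gamma> t) ** transpose (J t)) $ a $ b) (at t within {0..h})"
      by simp
  qed
  then obtain h' where "0 < h'" "h' \<le> h"
    and congruent: "\<And>t. t \<in> {0..h'} \<Longrightarrow> \<exists>S. P (\<gamma> t) = transpose S ** P (\<gamma> 0) ** S"
    using differential_lyapunov_congruent[OF \<open>0 < h\<close> J_cont] by blast
  show thesis
  proof (rule that[of h' \<gamma>, OF \<open>0 < h'\<close> \<open>\<gamma> 0 = x0\<close>])
    show "(\<gamma> has_vector_derivative column j (P x0)) (at 0 within {0..h'})"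
      using \<gamma>_deriv[of 0] \<open>0 < h\<close> \<open>h' \<le> h\<close> \<open>\<gamma> 0 = x0\<close>
      by (auto intro: has_vector_derivative_within_subset)
    show "\<exists>S. P (\<gamma> t) = transpose S ** P x0 ** S" if "t \<in> {0..h'}" for t
      using congruent that \<open>\<gamma> 0 = x0\<close> by auto
  qed
qed

lemma poisson_kernel_contains_gradient:
  fixes P :: "'a::{real_normed_field,euclidean_space}^'n \<Rightarrow> 'a^'n^'n" and f :: "'a^'n \<Rightarrow> 'a"
  assumes "open U" "x0 \<in> U"
    and C1: "\<And>a b. has_continuous_partials_on U (\<lambda>x. P x $ a $ b)" and "poisson_on U P"
    and f_deriv: "(f has_derivative (\<lambda>v. \<Sum>l\<in>UNIV. v $ l * pd f x0 l)) (at x0)"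
    and invariant: "\<forall>\<^sub>F y in nhds x0. (\<exists>S. P y = transpose S ** P x0 ** S) \<longrightarrow> f y = f x0"
  shows "P x0 *v (\<chi> l. pd f x0 l) = 0"
proof -
  have column_orthogonal: "(\<Sum>l\<in>UNIV. P x0 $ l $ j * pd f x0 l) = 0" for j
  proof (rule poisson_hamiltonian_flow_congruent[OF assms(1-4), where j = j])
    fix h \<gamma>
    assume "0 < h" "\<gamma> 0 = x0"
      and \<gamma>_deriv: "(\<gamma> has_vector_derivative column j (P x0)) (at 0 within {0..h})"
      and congruent: "\<And>t. t \<in> {0..h} \<Longrightarrow> \<exists>S. P (\<gamma> t) = transpose S ** P x0 ** S"
    have "(\<gamma> \<longlongrightarrow> x0) (at 0 within {0..h})"
      using has_vector_derivative_continuous[OF \<gamma>_deriv] \<open>\<gamma> 0 = x0\<close>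
      by (simp add: continuous_within)
    with invariant have "\<forall>\<^sub>F t in at 0 within {0..h}.
        (\<exists>S. P (\<gamma> t) = transpose S ** P x0 ** S) \<longrightarrow> f (\<gamma> t) = f x0"
      by (rule eventually_compose_filterlim)
    moreover have "\<forall>\<^sub>F t in at 0 within {0..h}. t \<in> {0..h}"
      by (simp add: eventually_at_filter)
    ultimately have "\<forall>\<^sub>F t in at 0 within {0..h}. f (\<gamma> t) = f x0"
      by eventually_elim (use congruent in blast)
    then obtain d where "0 < d"
      and d: "\<forall>t\<in>{0..h}. t \<noteq> 0 \<and> dist t 0 < d \<longrightarrow> f (\<gamma> t) = f x0"
      unfolding eventually_at by (elim exE conjE) (rule that)
    have "((\<lambda>t. f (\<gamma> t)) has_vector_derivative 0) (at 0 within {0..h})"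
    proof (rule has_vector_derivative_transform_within[OF has_vector_derivative_const \<open>0 < d\<close>])
      show "0 \<in> {0..h}" using \<open>0 < h\<close> by simp
      fix t assume t: "t \<in> {0..h}" "dist t 0 < d"
      show "f x0 = f (\<gamma> t)"
      proof (cases "t = 0")
        case True
        then show ?thesis using \<open>\<gamma> 0 = x0\<close> by simp
      next
        case False
        then show ?thesis using d t by simp
      qed
    qed
    moreover have "((\<lambda>t. f (\<gamma> t)) has_vector_derivative
        (\<Sum>l\<in>UNIV. column j (P x0) $ l * pd f x0 l)) (at 0 within {0..h})"
      using has_vector_derivative_chain_partials[OF \<gamma>_deriv] f_deriv \<open>\<gamma> 0 = x0\<close> by simp
    ultimately show ?thesis
      using vector_derivative_unique_within_closed_interval[of 0 h 0] \<open>0 < h\<close>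
      by (simp add: cbox_interval column_def)
  qed
  have "(\<Sum>j\<in>UNIV. P x0 $ i $ j * pd f x0 j) = - (\<Sum>j\<in>UNIV. P x0 $ j $ i * pd f x0 j)" for i
    by (subst poisson_on_skew[OF \<open>poisson_on U P\<close> \<open>x0 \<in> U\<close>]) (simp add: sum_negf)
  then show ?thesis
    using column_orthogonal by (simp add: matrix_vector_mult_def vec_eq_iff)
qed

lemma map_matrix_mult:
  fixes f :: "'a::comm_ring_1 \<Rightarrow> 'b::comm_ring_1"
  assumes "\<And>a b. f (a + b) = f a + f b" "\<And>a b. f (a * b) = f a * f b"
  shows "map_matrix f (X ** Y) = map_matrix f X ** map_matrix f (Y :: 'a^'p^'n)"
proof -
  interpret f: Modules.additive f by unfold_locales (rule assms(1))
  show ?thesis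
    by (simp add: map_matrix_def matrix_matrix_mult_def vec_eq_iff f.sum assms(2))
qed

lemma map_matrix_transpose: "map_matrix f (transpose X) = transpose (map_matrix f X)"
  by (simp add: map_matrix_def transpose_def)

lemma rank_map_matrix_congruent_le:
  fixes f :: "'a::comm_ring_1 \<Rightarrow> 'b::field"
  assumes "\<And>a b. f (a + b) = f a + f b" "\<And>a b. f (a * b) = f a * f b"
  shows "rank (map_matrix f (transpose S ** P ** S)) \<le> rank (map_matrix f (P :: 'a^'n^'n))"
  using rank_congruent_le[of "map_matrix f S" "map_matrix f P"]
  by (simp add: map_matrix_mult[OF assms] map_matrix_transpose)

lemma isolated_pencil_eigenvalue_gradient_in_kernel:
  fixes A B :: "'a::{real_normed_field,euclidean_space}^'n \<Rightarrow> 'a^'n^'n"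
    and lam :: "'a^'n \<Rightarrow> 'a" and \<iota> :: "'a \<Rightarrow> complex"
  assumes \<iota>: "inj \<iota>" "\<And>a b. \<iota> (a + b) = \<iota> a + \<iota> b" "\<And>a b. \<iota> (a * b) = \<iota> a * \<iota> b"
    and "open M"
    and A: "\<And>i j. has_continuous_partials_on M (\<lambda>x. A x $ i $ j)"
    and B: "\<And>i j. has_continuous_partials_on M (\<lambda>x. B x $ i $ j)"
    and lam: "has_continuous_partials_on M lam"
    and pencil: "poisson_pencil_on M A B"
    and eigenvalue: "\<And>x. x \<in> M \<Longrightarrow>
      pencil_eigenvalue (map_matrix \<iota> (A x)) (map_matrix \<iota> (B x)) (\<iota> (lam x))"
    and rank_const: "\<And>x y. x \<in> M \<Longrightarrow> y \<in> M \<Longrightarrow>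
      pencil_rank (map_matrix \<iota> (A x)) (map_matrix \<iota> (B x))
      = pencil_rank (map_matrix \<iota> (A y)) (map_matrix \<iota> (B y))"
    and "open V" and V: "\<And>x. x \<in> M \<Longrightarrow> (x, \<iota> (lam x)) \<in> V"
    and isolated: "\<And>x \<mu>. x \<in> M \<Longrightarrow> (x, \<mu>) \<in> V \<Longrightarrow> \<mu> \<noteq> \<iota> (lam x) \<Longrightarrow>
      \<not> pencil_eigenvalue (map_matrix \<iota> (A x)) (map_matrix \<iota> (B x)) \<mu>"
    and "p \<in> M"
  shows "(\<chi> i. \<Sum>j\<in>UNIV. (A p $ i $ j - lam p * B p $ i $ j) * pd lam p j) = 0"
proof -
  define c where "c = lam p"
  define P where "P = (\<lambda>y. \<chi> i j. A y $ i $ j - c * B y $ i $ j)"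
  have "has_continuous_partials_on M (\<lambda>y. A y $ a $ b + (- c) * B y $ a $ b)" for a b
    by (rule has_continuous_partials_on_add_scaled(1)[OF A B])
  then have P_C1: "has_continuous_partials_on M (\<lambda>y. P y $ a $ b)" for a b
    by (simp add: P_def)
  have "poisson_on M P"
    unfolding P_def by (rule poisson_on_pencil_member[OF pencil A B])
  have map_P: "map_matrix \<iota> (P y)
      = (\<chi> i j. map_matrix \<iota> (A y) $ i $ j - \<iota> c * map_matrix \<iota> (B y) $ i $ j)" for y
  proof -
    interpret \<iota>: Modules.additive \<iota> by unfold_locales (rule \<iota>(2))
    show ?thesis by (simp add: P_def map_matrix_def \<iota>.diff \<iota>(3))
  qed
  have "open ((\<lambda>y. (y, \<iota> c)) -` V)"
    by (rule open_vimage[OF \<open>open V\<close>]) (intro continuous_intros)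
  then have "\<forall>\<^sub>F y in nhds p. y \<in> (\<lambda>y. (y, \<iota> c)) -` V"
    by (rule eventually_nhds_in_open) (use V[OF \<open>p \<in> M\<close>] in \<open>simp add: c_def\<close>)
  then have "\<forall>\<^sub>F y in nhds p. (y, \<iota> c) \<in> V"
    by simp
  moreover have "\<forall>\<^sub>F y in nhds p. y \<in> M"
    using \<open>open M\<close> \<open>p \<in> M\<close> by (rule eventually_nhds_in_open)
  ultimately have "\<forall>\<^sub>F y in nhds p. (\<exists>S. P y = transpose S ** P p ** S) \<longrightarrow> lam y = lam p"
  proof eventually_elim
    case (elim y)
    show ?case
    proof
      assume "\<exists>S. P y = transpose S ** P p ** S"
      then obtain S where S: "P y = transpose S ** P p ** S" ..
      have "rank (map_matrix \<iota> (P y)) \<le> rank (map_matrix \<iota> (P p))"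
        unfolding S by (rule rank_map_matrix_congruent_le[OF \<iota>(2,3)])
      also have "\<dots> < pencil_rank (map_matrix \<iota> (A p)) (map_matrix \<iota> (B p))"
        using eigenvalue[OF \<open>p \<in> M\<close>] unfolding pencil_eigenvalue_def map_P c_def .
      also have "\<dots> = pencil_rank (map_matrix \<iota> (A y)) (map_matrix \<iota> (B y))"
        using rank_const \<open>p \<in> M\<close> elim by blast
      finally have "pencil_eigenvalue (map_matrix \<iota> (A y)) (map_matrix \<iota> (B y)) (\<iota> c)"
        unfolding pencil_eigenvalue_def map_P .
      then have "\<iota> c = \<iota> (lam y)"
        using isolated elim by blast
      then show "lam y = lam p"
        using \<iota>(1) unfolding c_def inj_def by auto
    qed
  qed
  moreover have "(lam has_derivative (\<lambda>v. \<Sum>l\<in>UNIV. v $ l * pd lam p l)) (at p)"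
    using lam \<open>p \<in> M\<close> unfolding has_continuous_partials_on_def by blast
  ultimately have "P p *v (\<chi> l. pd lam p l) = 0"
    by (intro poisson_kernel_contains_gradient[OF \<open>open M\<close> \<open>p \<in> M\<close> P_C1 \<open>poisson_on M P\<close>])
  then show ?thesis
    by (simp add: P_def c_def matrix_vector_mult_def)
qed

lemma cplx_eq_map_matrix: "cplx = map_matrix complex_of_real"
  by (simp add: fun_eq_iff cplx_def map_matrix_def)

lemma map_matrix_ident: "map_matrix (\<lambda>z. z) X = X"
  by (simp add: map_matrix_def)

theorem mainTheorem5:
  shows
  "(\<forall>(M :: (real^'n) set) (A :: real^'n \<Rightarrow> real^'n^'n) B (lam :: real^'n \<Rightarrow> real).
      open M \<and>
      (\<forall>i j. smooth_on M (\<lambda>x. A x $ i $ j) \<and> smooth_on M (\<lambda>x. B x $ i $ j)) \<and>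
      poisson_pencil_on M A B \<and>
      smooth_on M lam \<and>
      (\<forall>x\<in>M. pencil_eigenvalue (cplx (A x)) (cplx (B x)) (complex_of_real (lam x))) \<and>
      (\<forall>x\<in>M. \<forall>y\<in>M. pencil_rank (cplx (A x)) (cplx (B x)) = pencil_rank (cplx (A y)) (cplx (B y))) \<and>
      (\<exists>U :: ((real^'n) \<times> complex) set. open U \<and>
          (\<forall>x\<in>M. (x, complex_of_real (lam x)) \<in> U) \<and>
          (\<forall>x\<in>M. \<forall>\<mu>. (x, \<mu>) \<in> U \<and> \<mu> \<noteq> complex_of_real (lam x) \<longrightarrow>
                       \<not> pencil_eigenvalue (cplx (A x)) (cplx (B x)) \<mu>))
      \<longrightarrow> (\<forall>x\<in>M. (\<chi> i. \<Sum>j\<in>UNIV. (A x $ i $ j - lam x * B x $ i $ j) * pd lam x j) = 0))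
   \<and>
   (\<forall>(M :: (complex^'n) set) (A :: complex^'n \<Rightarrow> complex^'n^'n) B (lam :: complex^'n \<Rightarrow> complex).
      open M \<and>
      (\<forall>i j. holo_on M (\<lambda>x. A x $ i $ j) \<and> holo_on M (\<lambda>x. B x $ i $ j)) \<and>
      poisson_pencil_on M A B \<and>
      holo_on M lam \<and>
      (\<forall>x\<in>M. pencil_eigenvalue (A x) (B x) (lam x)) \<and>
      (\<forall>x\<in>M. \<forall>y\<in>M. pencil_rank (A x) (B x) = pencil_rank (A y) (B y)) \<and>
      (\<exists>U :: ((complex^'n) \<times> complex) set. open U \<and>
          (\<forall>x\<in>M. (x, lam x) \<in> U) \<and>
          (\<forall>x\<in>M. \<forall>\<mu>. (x, \<mu>) \<in> U \<and> \<mu> \<noteq> lam x \<longrightarrow> \<not> pencil_eigenvalue (A x) (B x) \<mu>))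
      \<longrightarrow> (\<forall>x\<in>M. (\<chi> i. \<Sum>j\<in>UNIV. (A x $ i $ j - lam x * B x $ i $ j) * pd lam x j) = 0))"
proof ((intro conjI allI impI ballI; elim conjE exE), goal_cases real complex)
  case (real M A B lam x V)
  note hyps = real[unfolded cplx_eq_map_matrix]
  show ?case
  proof (rule isolated_pencil_eigenvalue_gradient_in_kernel[where \<iota> = complex_of_real and M = M and A = A and B = B and lam = lam and V = V and p = x])
    show "inj complex_of_real"
      by (simp add: inj_def)
  qed (simp only: of_real_add of_real_mult
      | use hyps in \<open>blast intro: smooth_on_has_continuous_partials\<close>)+
next
  case (complex M A B lam x V)
  show ?case
  proof (rule isolated_pencil_eigenvalue_gradient_in_kernel[where \<iota> = "\<lambda>z. z" and M = M and A = A and B = B and lam = lam and V = V and p = x])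
    show "inj (\<lambda>z::complex. z)"
      by (simp add: inj_def)
  qed (rule refl | simp only: map_matrix_ident
      | use complex in \<open>blast intro: holo_on_has_continuous_partials\<close>)+
qed

end
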